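(* Let $p:\mathbb Z^2\to\hat{\mathbb C}$ be a P-net, and let $\mathcal L=\{(i,j,k)\in\mathbb Z^3: i+j+k\in 2\mathbb Z\}$. Then the function $x:\mathcal L\to\hat{\mathbb C}$ given by $x(i,j,k)=p_{i,k}$ satisfies the dSKP recurrence.
   Context: $\hat{\mathbb C}=\mathbb C\cup\{\infty\}$ is identified with $\mathbb{CP}^1$ (an affine chart), with the usual arithmetic rules. A P-net is a map $p:\mathbb Z^2\to\hat{\mathbb C}$ such that for all $(i,j)\in\mathbb Z^2$ $$\frac{1}{p_{i+1,j}-p_{i,j}}-\frac{1}{p_{i,j+1}-p_{i,j}}+\frac{1}{p_{i-1,j}-p_{i,j}}-\frac{1}{p_{i,j-1}-p_{i,j}}=0 .$$ A function $x:\mathcal L\to\hat{\mathbb C}$ satisfies the dSKP recurrence if, at every $P\in\mathbb Z^3\setminus\mathcal L$, $$\frac{(x_{-e_3}-x_{e_2})(x_{-e_1}-x_{e_3})(x_{-e_2}-x_{e_1})}{(x_{e_2}-x_{-e_1})(x_{e_3}-x_{-e_2})(x_{e_1}-x_{-e_3})}=-1,$$ where $(e_1,e_2,e_3)$ is the canonical basis of $\mathbb Z^3$ and $x_q=x(P+q)$ for $q\in\{\pm e_1,\pm e_2,\pm e_3\}$. Standing assumption: the data are generic, i.e. all expressions are well defined (no indeterminate $0/0$). *)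

theory Defs
  imports Complex_Main "HOL-Library.Monad_Syntax" "HOL-Library.Product_Plus"
begin

text \<open>The extended complex plane, with the usual arithmetic. Indeterminate
  expressions evaluate to \<^term>\<open>None\<close>.\<close>

datatype ecomplex = Fin complex | Infty

fun eadd :: "ecomplex \<Rightarrow> ecomplex \<Rightarrow> ecomplex option" where
  "eadd (Fin a) (Fin b) = Some (Fin (a + b))"
| "eadd (Fin a) Infty = Some Infty"
| "eadd Infty (Fin b) = Some Infty"
| "eadd Infty Infty = None"

fun ediff :: "ecomplex \<Rightarrow> ecomplex \<Rightarrow> ecomplex option" where
  "ediff (Fin a) (Fin b) = Some (Fin (a - b))"
| "ediff (Fin a) Infty = Some Infty"
| "ediff Infty (Fin b) = Some Infty"
| "ediff Infty Infty = None"

fun einv :: "ecomplex \<Rightarrow> ecomplex" where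
  "einv (Fin z) = (if z = 0 then Infty else Fin (1 / z))"
| "einv Infty = Fin 0"

text \<open>The value of \<open>1/(a-c) - 1/(b-c) + 1/(a'-c) - 1/(b'-c)\<close>.\<close>

definition pnet_expr ::
    "ecomplex \<Rightarrow> ecomplex \<Rightarrow> ecomplex \<Rightarrow> ecomplex \<Rightarrow> ecomplex \<Rightarrow> ecomplex option" where
  "pnet_expr c a b a' b' = do {
     u \<leftarrow> ediff a c;
     v \<leftarrow> ediff b c;
     u' \<leftarrow> ediff a' c;
     v' \<leftarrow> ediff b' c;
     s \<leftarrow> ediff (einv u) (einv v);
     t \<leftarrow> eadd s (einv u');
     ediff t (einv v')
   }"

text \<open>The P-net equation is invariant under changes of affine chart that keep the
  centre \<open>c\<close> finite. For \<open>c = \<infinity>\<close> the formula itself would degenerate to \<open>0 = 0\<close>,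
  for all finite neighbours; there the equation is read in the chart \<open>w = 1/z\<close>
  of the projective line, where the centre is \<open>0\<close>.\<close>

definition pnet_eq ::
    "ecomplex \<Rightarrow> ecomplex \<Rightarrow> ecomplex \<Rightarrow> ecomplex \<Rightarrow> ecomplex \<Rightarrow> bool" where
  "pnet_eq c a b a' b' \<longleftrightarrow>
     (if c \<noteq> Infty then pnet_expr c a b a' b' = Some (Fin 0)
      else pnet_expr (einv c) (einv a) (einv b) (einv a') (einv b') = Some (Fin 0))"

definition is_pnet :: "(int \<times> int \<Rightarrow> ecomplex) \<Rightarrow> bool" where
  "is_pnet p \<longleftrightarrow> (\<forall>i j. pnet_eq (p (i, j)) (p (i + 1, j)) (p (i, j + 1)) (p (i - 1, j)) (p (i, j - 1)))"

lemma pnet_eq_Fin: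
  assumes "a \<noteq> c" "b \<noteq> c" "a' \<noteq> c" "b' \<noteq> c"
  shows "pnet_eq (Fin c) (Fin a) (Fin b) (Fin a') (Fin b') \<longleftrightarrow>
    1 / (a - c) - 1 / (b - c) + 1 / (a' - c) - 1 / (b' - c) = 0"
  using assms by (simp add: pnet_eq_def pnet_expr_def)

lemma pnet_expr_chart:
  assumes "c \<noteq> 0"
  shows "pnet_expr (einv (Fin c)) (einv a) (einv b) (einv a') (einv b') = Some (Fin 0) \<longleftrightarrow>
    pnet_expr (Fin c) a b a' b' = Some (Fin 0)"
proof -
  define r where "r = (\<lambda>q. case q of Infty \<Rightarrow> 0 | Fin z \<Rightarrow> 1 / (z - c))"
  have diff: "\<exists>y. ediff q (Fin d) = Some y" for q d
    by (cases q) auto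
  have key: "ediff (einv q) (einv (Fin c)) = Some y \<Longrightarrow> ediff q (Fin c) = Some z \<Longrightarrow>
      (if q = Fin c then einv y = Infty \<and> einv z = Infty
       else einv z = Fin (r q) \<and> einv y = Fin (- c - c\<^sup>2 * r q))" for q y z
    using assms
    by (cases q) (auto simp: r_def field_simps power2_eq_square split: if_splits)
  have fin: "einv (Fin c) = Fin (1 / c)" using assms by simp
  obtain ya yb ya' yb' where y:
      "ediff (einv a) (einv (Fin c)) = Some ya" "ediff (einv b) (einv (Fin c)) = Some yb"
      "ediff (einv a') (einv (Fin c)) = Some ya'" "ediff (einv b') (einv (Fin c)) = Some yb'"
    unfolding fin using diff by metis
  obtain za zb za' zb' where z:
      "ediff a (Fin c) = Some za" "ediff b (Fin c) = Some zb"
      "ediff a' (Fin c) = Some za'" "ediff b' (Fin c) = Some zb'"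
    using diff by metis
  have alg: "(- c - c\<^sup>2 * s - (- c - c\<^sup>2 * t) + (- c - c\<^sup>2 * s') - (- c - c\<^sup>2 * t') = 0)
      \<longleftrightarrow> s - t + s' - t' = 0" for s t s' t'
  proof -
    have "- c - c\<^sup>2 * s - (- c - c\<^sup>2 * t) + (- c - c\<^sup>2 * s') - (- c - c\<^sup>2 * t')
        = - c\<^sup>2 * (s - t + s' - t')" by (simp add: algebra_simps)
    then show ?thesis using assms by simp
  qed
  show ?thesis
    using key[OF y(1) z(1)] key[OF y(2) z(2)] key[OF y(3) z(3)] key[OF y(4) z(4)] alg
    by (auto simp: pnet_expr_def y z simp del: einv.simps split: if_splits)
qed

text \<open>Homogeneous coordinates of a point of the projective line; the bracket of two
  points is their difference if both are finite.\<close>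

fun hom_coords :: "ecomplex \<Rightarrow> complex \<times> complex" where
  "hom_coords (Fin z) = (z, 1)"
| "hom_coords Infty = (1, 0)"

definition bracket :: "ecomplex \<Rightarrow> ecomplex \<Rightarrow> complex" where
  "bracket x y = fst (hom_coords x) * snd (hom_coords y) - snd (hom_coords x) * fst (hom_coords y)"

lemma bracket_Fin [simp]: "bracket (Fin z) (Fin w) = z - w"
  by (simp add: bracket_def)

text \<open>The point \<open>n/d\<close>, indeterminate exactly for \<open>0/0\<close>.\<close>

definition equot :: "complex \<Rightarrow> complex \<Rightarrow> ecomplex option" where
  "equot n d = (if d \<noteq> 0 then Some (Fin (n / d)) else if n \<noteq> 0 then Some Infty else None)"

definition e1 :: "int \<times> int \<times> int" where "e1 = (1, 0, 0)"
definition e2 :: "int \<times> int \<times> int" where "e2 = (0, 1, 0)"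
definition e3 :: "int \<times> int \<times> int" where "e3 = (0, 0, 1)"

definition even_lattice :: "(int \<times> int \<times> int) set" where
  "even_lattice = {(i, j, k). even (i + j + k)}"

text \<open>The left-hand side of the dSKP equation at \<open>P\<close>. Each of the six values occurs once in
  the numerator and once in the denominator, so the quotient does not depend on the choice of
  homogeneous coordinates, and factors involving \<open>\<infinity>\<close> cancel up to sign, as in
  \<open>(z - \<infinity>)/(\<infinity> - w) = -1\<close>.\<close>

definition dSKP_expr ::
    "(int \<times> int \<times> int \<Rightarrow> ecomplex) \<Rightarrow> int \<times> int \<times> int \<Rightarrow> ecomplex option" where
  "dSKP_expr x P = equot
     (bracket (x (P - e3)) (x (P + e2)) * bracket (x (P - e1)) (x (P + e3)) * bracket (x (P - e2)) (x (P + e1)))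
     (bracket (x (P + e2)) (x (P - e1)) * bracket (x (P + e3)) (x (P - e2)) * bracket (x (P + e1)) (x (P - e3)))"

text \<open>A function on the even lattice is represented by a total function. The two predicates
  below only use its values on that lattice, since all six neighbours of a point outside it
  belong to it.\<close>

definition dSKP_generic :: "(int \<times> int \<times> int \<Rightarrow> ecomplex) \<Rightarrow> bool" where
  "dSKP_generic x \<longleftrightarrow> (\<forall>P. P \<notin> even_lattice \<longrightarrow> dSKP_expr x P \<noteq> None)"

definition satisfies_dSKP :: "(int \<times> int \<times> int \<Rightarrow> ecomplex) \<Rightarrow> bool" where
  "satisfies_dSKP x \<longleftrightarrow> (\<forall>P. P \<notin> even_lattice \<longrightarrow> dSKP_expr x P = Some (Fin (- 1)))"

end

theory Submission
  imports Defs
begin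

text \<open>As \<open>p\<close> ignores the coordinate \<open>j\<close>, both neighbours of
  \<open>P\<close> in direction \<open>e2\<close> carry the same net value c; the other four carry
  the net neighbours a, b, a', b' of c. Writing the P-net equation as 1/(a'-c) - 1/(b-c) = 1/(b'-c)
  - 1/(a-c) and clearing denominators shows that the dSKP numerator is minus the denominator
  (\<open>pnet_eq_imp_bracket_eq\<close>). Genericity excludes 0/0, so the quotient is -1.\<close>

lemma bracket_Infty [simp]:
  "bracket (Fin z) Infty = - 1" "bracket Infty (Fin z) = 1" "bracket Infty Infty = 0"
  by (simp_all add: bracket_def)

text \<open>Free of division, this form also covers infinite values and vanishing products.\<close>

lemma pnet_eq_imp_bracket_eq:
  assumes "pnet_eq c a b a' b'"
  shows "bracket b' c * bracket a' b * bracket c a = - (bracket c a' * bracket b c * bracket a b')"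
proof (cases c)
  case [simp]: Infty
  \<comment> \<open>In the chart 1/z the P-net equation becomes a - b + a' - b' = 0 with all four
    finite.\<close>
  show ?thesis
    using assms
    by (cases a; cases b; cases a'; cases b';
        auto simp: pnet_eq_def pnet_expr_def algebra_simps split: if_splits)
next
  case [simp]: (Fin z)
  \<comment> \<open>In the chart \<open>R\<close>, which sends the centre \<open>c\<close> to infinity, both equations become linear.\<close>
  define R where "R q = (case q of Infty \<Rightarrow> 0 | Fin w \<Rightarrow> 1 / (w - z))" for q
  \<comment> \<open>A neighbour equal to \<open>c\<close> would give an infinite term, and then the
    sum could not be 0.\<close>
  have ne: "a \<noteq> c" "b \<noteq> c" "a' \<noteq> c" "b' \<noteq> c" and sum: "R a - R b + R a' - R b' = 0"
    using assms
    by (cases a; cases b; cases a'; cases b';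
        auto simp: pnet_eq_def pnet_expr_def R_def split: if_splits)+
  have diff: "bracket q q' = bracket q c * bracket q' c * (R q' - R q)"
    if "q \<noteq> c" "q' \<noteq> c" for q q'
    using that by (cases q; cases q') (auto simp: R_def diff_frac_eq)
  have swap: "bracket c q = - bracket q c" for q
    by (simp add: bracket_def)
  \<comment> \<open>Up to sign, both sides contain the product of the brackets of all four
    neighbours with \<open>c\<close>; the remaining factors agree by \<open>sum\<close>.\<close>
  show ?thesis
    unfolding diff[OF ne(3,2)] diff[OF ne(1,4)] swap using sum by algebra
qed

lemma equot_eq_minus_1:
  assumes "equot n d \<noteq> None" "n = - d"
  shows "equot n d = Some (Fin (- 1))"
  using assms by (auto simp: equot_def split: if_splits)

theorem theorem1p1:
  fixes p :: "int \<times> int \<Rightarrow> ecomplex" and x :: "int \<times> int \<times> int \<Rightarrow> ecomplex"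
  assumes pnet: "is_pnet p"
    and x_eq: "\<And>i j k. (i, j, k) \<in> even_lattice \<Longrightarrow> x (i, j, k) = p (i, k)"
    and generic: "dSKP_generic x"
  shows "satisfies_dSKP x"
  unfolding satisfies_dSKP_def
proof (intro allI impI)
  fix P assume P: "P \<notin> even_lattice"
  obtain i j k where ijk: "P = (i, j, k)" by (metis prod_cases3)
  have "odd (i + j + k)" using P by (simp add: ijk even_lattice_def)
  then have even: "(i - 1, j, k) \<in> even_lattice" "(i + 1, j, k) \<in> even_lattice"
    "(i, j - 1, k) \<in> even_lattice" "(i, j + 1, k) \<in> even_lattice"
    "(i, j, k - 1) \<in> even_lattice" "(i, j, k + 1) \<in> even_lattice"
    by (auto simp: even_lattice_def)
  have x: "x (P - e1) = p (i - 1, k)" "x (P + e1) = p (i + 1, k)"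
    "x (P - e2) = p (i, k)" "x (P + e2) = p (i, k)"
    "x (P - e3) = p (i, k - 1)" "x (P + e3) = p (i, k + 1)"
    using even[THEN x_eq] by (simp_all add: ijk e1_def e2_def e3_def)
  have "pnet_eq (p (i, k)) (p (i + 1, k)) (p (i, k + 1)) (p (i - 1, k)) (p (i, k - 1))"
    using pnet by (simp add: is_pnet_def)
  from pnet_eq_imp_bracket_eq[OF this] show "dSKP_expr x P = Some (Fin (- 1))"
    using generic P unfolding dSKP_generic_def dSKP_expr_def
    by (intro equot_eq_minus_1) (blast, simp only: x)
qed

end
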